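(* Let $\mathbb{P}$ be a $\sigma$-centered forcing notion such that above every element of $\mathbb{P}$ there are two incompatible elements, and suppose $\mathbb{P}$ does not add a Cohen real. Then there exists a non-principal nowhere dense ultrafilter on $\omega$.
   Context: Forcing order convention: $p\leqslant q$ means $q$ is stronger (extends) $p$; "above $p$" means $\geqslant p$. $\mathbb{P}$ is $\sigma$-centered if $\mathbb{P}=\bigcup_{n<\omega}A_n$ where each $A_n$ is directed: for all $p,q\in A_n$ there is $r\in A_n$ with $p\leqslant r$ and $q\leqslant r$. $\mathbb{P}$ adds a Cohen real if there is a $\mathbb{P}$-name $\underline{r}$ for an element of ${}^\omega 2$ such that for every open dense set $\mathcal{D}\subseteq{}^\omega 2$ in the ground model, $\Vdash_{\mathbb{P}}\underline{r}\in\mathcal{D}^*$, where $\mathcal{D}^*$ is the reinterpretation (the open set coded by the same code) of $\mathcal{D}$ in the extension. A filter $D$ on $\omega$ is nowhere dense if for every function $f\colon\omega\to{}^\omega 2$ there is $A\in D$ such that $f(A)$ is nowhere dense in ${}^\omega 2$. *)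

theory Defs
  imports Main "HOL-Library.Sublist"
begin

definition cyl :: "bool list \<Rightarrow> (nat \<Rightarrow> bool) set" where
  "cyl s = {x. \<forall>i<length s. x i = s ! i}"

definition cantor_open :: "(nat \<Rightarrow> bool) set \<Rightarrow> bool" where
  "cantor_open D \<longleftrightarrow> (\<forall>x\<in>D. \<exists>s. x \<in> cyl s \<and> cyl s \<subseteq> D)"

definition cantor_dense :: "(nat \<Rightarrow> bool) set \<Rightarrow> bool" where
  "cantor_dense D \<longleftrightarrow> (\<forall>s. cyl s \<inter> D \<noteq> {})"

definition cantor_nowhere_dense :: "(nat \<Rightarrow> bool) set \<Rightarrow> bool" where
  "cantor_nowhere_dense A \<longleftrightarrow> (\<forall>s. \<exists>t. prefix s t \<and> cyl t \<inter> A = {})"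

definition is_filter :: "nat set set \<Rightarrow> bool" where
  "is_filter U \<longleftrightarrow> UNIV \<in> U \<and> {} \<notin> U \<and>
     (\<forall>A B. A \<in> U \<longrightarrow> A \<subseteq> B \<longrightarrow> B \<in> U) \<and>
     (\<forall>A B. A \<in> U \<longrightarrow> B \<in> U \<longrightarrow> A \<inter> B \<in> U)"

definition is_ultrafilter :: "nat set set \<Rightarrow> bool" where
  "is_ultrafilter U \<longleftrightarrow> is_filter U \<and> (\<forall>A. A \<in> U \<or> - A \<in> U)"

definition non_principal :: "nat set set \<Rightarrow> bool" where
  "non_principal U \<longleftrightarrow> (\<forall>n. {n} \<notin> U)"

definition nowhere_dense_filter :: "nat set set \<Rightarrow> bool" where
  "nowhere_dense_filter U \<longleftrightarrow>
     (\<forall>f :: nat \<Rightarrow> (nat \<Rightarrow> bool). \<exists>A\<in>U. cantor_nowhere_dense (f ` A))"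

section \<open>Forcing notions (P, le); le p q means q is stronger than p\<close>

definition forcing_notion :: "'a set \<Rightarrow> ('a \<Rightarrow> 'a \<Rightarrow> bool) \<Rightarrow> bool" where
  "forcing_notion P le \<longleftrightarrow> P \<noteq> {} \<and> (\<forall>p\<in>P. le p p) \<and>
     (\<forall>p\<in>P. \<forall>q\<in>P. \<forall>r\<in>P. le p q \<longrightarrow> le q r \<longrightarrow> le p r)"

definition compatible :: "'a set \<Rightarrow> ('a \<Rightarrow> 'a \<Rightarrow> bool) \<Rightarrow> 'a \<Rightarrow> 'a \<Rightarrow> bool" where
  "compatible P le p q \<longleftrightarrow> (\<exists>r\<in>P. le p r \<and> le q r)"

definition directed_in :: "('a \<Rightarrow> 'a \<Rightarrow> bool) \<Rightarrow> 'a set \<Rightarrow> bool" where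
  "directed_in le A \<longleftrightarrow> (\<forall>p\<in>A. \<forall>q\<in>A. \<exists>r\<in>A. le p r \<and> le q r)"

definition sigma_centered :: "'a set \<Rightarrow> ('a \<Rightarrow> 'a \<Rightarrow> bool) \<Rightarrow> bool" where
  "sigma_centered P le \<longleftrightarrow>
     (\<exists>A :: nat \<Rightarrow> 'a set. P = (\<Union>n. A n) \<and> (\<forall>n. directed_in le (A n)))"

definition splitting :: "'a set \<Rightarrow> ('a \<Rightarrow> 'a \<Rightarrow> bool) \<Rightarrow> bool" where
  "splitting P le \<longleftrightarrow> (\<forall>p\<in>P. \<exists>q\<in>P. \<exists>r\<in>P. le p q \<and> le p r \<and> \<not> compatible P le q r)"

definition dense_in :: "'a set \<Rightarrow> ('a \<Rightarrow> 'a \<Rightarrow> bool) \<Rightarrow> 'a set \<Rightarrow> bool" where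
  "dense_in P le E \<longleftrightarrow> (\<forall>p\<in>P. \<exists>q\<in>P. le p q \<and> q \<in> E)"

text \<open>A P-name for an element of 2^omega is coded by the map tau sending a condition q
  to the (longest) initial segment of the real that q decides: tau is monotone, and for
  every n the conditions deciding at least n digits are dense.  The name is forced into
  the reinterpretation D* of a ground-model open set D iff densely many conditions q
  decide an initial segment whose cylinder lies inside D.\<close>
definition real_name :: "'a set \<Rightarrow> ('a \<Rightarrow> 'a \<Rightarrow> bool) \<Rightarrow> ('a \<Rightarrow> bool list) \<Rightarrow> bool" where
  "real_name P le \<tau> \<longleftrightarrow>
     (\<forall>p\<in>P. \<forall>q\<in>P. le p q \<longrightarrow> prefix (\<tau> p) (\<tau> q)) \<and>
     (\<forall>n. dense_in P le {q. n \<le> length (\<tau> q)})"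

definition forces_in_open :: "'a set \<Rightarrow> ('a \<Rightarrow> 'a \<Rightarrow> bool) \<Rightarrow> ('a \<Rightarrow> bool list)
    \<Rightarrow> (nat \<Rightarrow> bool) set \<Rightarrow> bool" where
  "forces_in_open P le \<tau> D \<longleftrightarrow> dense_in P le {q. cyl (\<tau> q) \<subseteq> D}"

definition adds_cohen_real :: "'a set \<Rightarrow> ('a \<Rightarrow> 'a \<Rightarrow> bool) \<Rightarrow> bool" where
  "adds_cohen_real P le \<longleftrightarrow>
     (\<exists>\<tau>. real_name P le \<tau> \<and>
        (\<forall>D. cantor_open D \<and> cantor_dense D \<longrightarrow> forces_in_open P le \<tau> D))"

end

theory Submission
  imports Defs
begin

text \<open>
  Cover \<open>P\<close> by countably many directed sets and extend the cones of the \<open>n\<close>-th one to an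
  ultrafilter \<open>V n\<close> of subsets of \<open>P\<close> that contains all dense upsets; up to its trace on upsets this
  is a point \<open>x\<^sub>n\<close> of the Stone space of \<open>P\<close>, and the \<open>x\<^sub>n\<close> form a countable dense set.
  For each \<open>i\<close> one can choose a countable maximal antichain of upsets \<open>W i k\<close> that misses \<open>x\<^sub>i\<close>
  but covers all other \<open>x\<^sub>n\<close>. It carries \<open>x\<^sub>i\<close> to a non-principal ultrafilter \<open>U\<^sub>i\<close> on \<open>\<omega>\<close>.
  If no \<open>U\<^sub>i\<close> were nowhere dense, as witnessed by \<open>f\<^sub>i\<close>, then the concatenation over \<open>i\<close> of the finite
  sequences \<open>f\<^sub>i k\<close> restricted to \<open>k + 1\<close>, where \<open>W i k\<close> is the element of the \<open>i\<close>-th antichain met by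
  the generic filter, would be a Cohen real: a condition near \<open>x\<^sub>n\<close> decides the stages before
  the first \<open>i\<close> with \<open>x\<^sub>i = x\<^sub>n\<close>, and at stage \<open>i\<close> it leaves a somewhere dense set of continuations.
\<close>

section \<open>Ultrafilters of sets\<close>

definition set_ultrafilter :: "'a set set \<Rightarrow> bool" where
  "set_ultrafilter V \<longleftrightarrow> {} \<notin> V \<and> (\<forall>S T. S \<in> V \<longrightarrow> S \<subseteq> T \<longrightarrow> T \<in> V) \<and>
     (\<forall>S T. S \<in> V \<longrightarrow> T \<in> V \<longrightarrow> S \<inter> T \<in> V) \<and> (\<forall>S. S \<in> V \<or> - S \<in> V)"

lemma set_ultrafilterD:
  assumes "set_ultrafilter V"
  shows "{} \<notin> V" "\<And>S T. S \<in> V \<Longrightarrow> S \<subseteq> T \<Longrightarrow> T \<in> V" "\<And>S T. S \<in> V \<Longrightarrow> T \<in> V \<Longrightarrow> S \<inter> T \<in> V"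
    "\<And>S. S \<notin> V \<Longrightarrow> - S \<in> V"
  using assms unfolding set_ultrafilter_def by blast+

lemma set_ultrafilter_Un:
  assumes "set_ultrafilter V" "S \<union> T \<in> V" "S \<notin> V"
  shows "T \<in> V"
proof -
  have "(S \<union> T) \<inter> - S \<in> V" using set_ultrafilterD[OF assms(1)] assms by blast
  then show ?thesis by (rule set_ultrafilterD(2)[OF assms(1)]) blast
qed

lemma set_ultrafilter_INT:
  assumes "set_ultrafilter V" "finite I" "S \<in> V" "\<And>i. i \<in> I \<Longrightarrow> T i \<in> V"
  shows "S \<inter> (\<Inter>i\<in>I. T i) \<in> V"
  using assms(2,4)
proof (induction I)
  case empty
  then show ?case using assms(3) by simp
next
  case (insert i I)
  then have "T i \<inter> (S \<inter> (\<Inter>i\<in>I. T i)) \<in> V" using set_ultrafilterD(3)[OF assms(1)] by blast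
  then show ?case by (simp add: Int_ac)
qed

text \<open>Zorn's lemma on the proper filters containing \<open>B\<close>; the filter generated by
  \<open>B\<close> shows that there is one.\<close>

lemma set_ultrafilter_extension:
  assumes "{} \<notin> B" "B \<noteq> {}" "\<And>S T. S \<in> B \<Longrightarrow> T \<in> B \<Longrightarrow> \<exists>R\<in>B. R \<subseteq> S \<inter> T"
  shows "\<exists>V. set_ultrafilter V \<and> B \<subseteq> V"
proof -
  define F where "F = {G. B \<subseteq> G \<and> {} \<notin> G \<and> (\<forall>S T. S \<in> G \<longrightarrow> S \<subseteq> T \<longrightarrow> T \<in> G) \<and>
    (\<forall>S T. S \<in> G \<longrightarrow> T \<in> G \<longrightarrow> S \<inter> T \<in> G)}"
  have "S \<inter> T \<in> {S. \<exists>R\<in>B. R \<subseteq> S}" if S: "S \<in> {S. \<exists>R\<in>B. R \<subseteq> S}" and T: "T \<in> {S. \<exists>R\<in>B. R \<subseteq> S}" for S T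
  proof -
    obtain R where R: "R \<in> B" "R \<subseteq> S" using S by blast
    obtain R' where R': "R' \<in> B" "R' \<subseteq> T" using T by blast
    obtain Q where Q: "Q \<in> B" "Q \<subseteq> R \<inter> R'" using assms(3)[OF R(1) R'(1)] by blast
    have "Q \<subseteq> S \<inter> T" using Q(2) R(2) R'(2) by blast
    with Q(1) show ?thesis by auto
  qed
  moreover have "T \<in> {S. \<exists>R\<in>B. R \<subseteq> S}" if S: "S \<in> {S. \<exists>R\<in>B. R \<subseteq> S}" "S \<subseteq> T" for S T
  proof -
    obtain R where "R \<in> B" "R \<subseteq> S" using S(1) by blast
    moreover from this have "R \<subseteq> T" using S(2) by simp
    ultimately show ?thesis by auto
  qed
  moreover have "B \<subseteq> {S. \<exists>R\<in>B. R \<subseteq> S}" by auto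
  moreover have "{} \<notin> {S. \<exists>R\<in>B. R \<subseteq> S}" using assms(1) by auto
  ultimately have "{S. \<exists>R\<in>B. R \<subseteq> S} \<in> F"
    unfolding F_def by simp
  then have "F \<noteq> {}" by blast
  moreover have "\<Union>C \<in> F" if "C \<noteq> {}" "subset.chain F C" for C
  proof -
    have C: "C \<subseteq> F" "\<And>G H. G \<in> C \<Longrightarrow> H \<in> C \<Longrightarrow> G \<subseteq> H \<or> H \<subseteq> G"
      using that(2) by (auto simp: subset_chain_def)
    have "S \<inter> T \<in> \<Union>C" if ST: "S \<in> \<Union>C" "T \<in> \<Union>C" for S T
    proof -
      obtain G H where GH: "G \<in> C" "H \<in> C" "S \<in> G" "T \<in> H" using ST by blast
      then obtain K where "K \<in> C" "S \<in> K" "T \<in> K" using C(2)[OF GH(1,2)] by blast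
      moreover from this have "S \<inter> T \<in> K" using C(1) unfolding F_def by auto
      ultimately show ?thesis by blast
    qed
    moreover have "B \<subseteq> \<Union>C" using C(1) \<open>C \<noteq> {}\<close> unfolding F_def by fast
    moreover have "{} \<notin> \<Union>C" using C(1) unfolding F_def by auto
    moreover have "T \<in> \<Union>C" if S: "S \<in> \<Union>C" "S \<subseteq> T" for S T
    proof -
      obtain G where G: "G \<in> C" "S \<in> G" using S(1) by blast
      then have "T \<in> G" using S(2) C(1) unfolding F_def by auto
      with G(1) show ?thesis by blast
    qed
    ultimately show ?thesis unfolding F_def by simp
  qed
  ultimately obtain M where M: "M \<in> F" "\<And>G. G \<in> F \<Longrightarrow> M \<subseteq> G \<Longrightarrow> G = M"
    using subset_Zorn_nonempty[of F] by blast
  have MB: "B \<subseteq> M" and M0: "{} \<notin> M" and Mup: "\<And>S T. S \<in> M \<Longrightarrow> S \<subseteq> T \<Longrightarrow> T \<in> M"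
    and MI: "\<And>S T. S \<in> M \<Longrightarrow> T \<in> M \<Longrightarrow> S \<inter> T \<in> M"
    using M(1) unfolding F_def by auto
  \<comment> \<open>Adjoining \<open>S\<close> to \<open>M\<close> gives a strictly larger
    \<open>G\<close>; by maximality \<open>G\<close> is improper, so some \<open>R \<in> M\<close>
    is disjoint from \<open>S\<close>.\<close>
  have "- S \<in> M" if "S \<notin> M" for S
  proof -
    define G where "G = {T. \<exists>R\<in>M. R \<inter> S \<subseteq> T}"
    have "M \<subseteq> G" unfolding G_def by blast
    have "T \<inter> T' \<in> G" if TT: "T \<in> G" "T' \<in> G" for T T'
    proof -
      obtain R where R: "R \<in> M" "R \<inter> S \<subseteq> T" using TT(1) unfolding G_def by blast
      obtain R' where R': "R' \<in> M" "R' \<inter> S \<subseteq> T'" using TT(2) unfolding G_def by blast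
      have "R \<inter> R' \<in> M" using R(1) R'(1) by (rule MI)
      moreover have "(R \<inter> R') \<inter> S \<subseteq> T \<inter> T'" using R(2) R'(2) by blast
      ultimately show ?thesis unfolding G_def by blast
    qed
    moreover have "T' \<in> G" if "T \<in> G" "T \<subseteq> T'" for T T' using that unfolding G_def by blast
    moreover have "S \<in> G" using MB \<open>B \<noteq> {}\<close> unfolding G_def by blast
    moreover have "B \<subseteq> G" using MB \<open>M \<subseteq> G\<close> by (rule subset_trans)
    ultimately have "G \<in> F" if "{} \<notin> G" using that unfolding F_def by simp
    then have "{} \<in> G" using M(2)[of G] \<open>M \<subseteq> G\<close> \<open>S \<in> G\<close> \<open>S \<notin> M\<close> by blast
    then show ?thesis unfolding G_def using Mup by blast
  qed
  then have "set_ultrafilter M" unfolding set_ultrafilter_def using M0 Mup MI by blast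
  then show ?thesis using MB by blast
qed

section \<open>Nowhere dense sets in the Cantor space\<close>

lemma cyl_antimono: "prefix s t \<Longrightarrow> cyl t \<subseteq> cyl s"
  by (auto simp: cyl_def prefix_def nth_append)

lemma mem_cyl_iff: "x \<in> cyl s \<longleftrightarrow> s = map x [0..<length s]"
  unfolding cyl_def by (subst list_eq_iff_nth_eq) auto

lemma mem_cyl_prefix: "x \<in> cyl s \<Longrightarrow> length s \<le> n \<Longrightarrow> prefix s (map x [0..<n])"
  by (metis mem_cyl_iff map_append prefixI le_iff_add upt_add_eq_append zero_le)

lemma dense_open_extension:
  assumes "cantor_open D" "cantor_dense D"
  shows "\<exists>u. prefix s u \<and> cyl u \<subseteq> D"
proof -
  obtain x where x: "x \<in> cyl s" "x \<in> D" using assms(2) unfolding cantor_dense_def by blast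
  then obtain t where t: "x \<in> cyl t" "cyl t \<subseteq> D" using assms(1) unfolding cantor_open_def by blast
  let ?u = "map x [0..<length s + length t]"
  have "prefix s ?u" "prefix t ?u" using mem_cyl_prefix x t by simp_all
  then show ?thesis using t(2) cyl_antimono by blast
qed

text \<open>Cantor's diagonal argument: \<open>s\<close> is prolonged so as to exclude the finitely many
  \<open>f k\<close> with \<open>k < length s\<close>.\<close>
lemma somewhere_dense_initial_segments:
  assumes "\<not> cantor_nowhere_dense (f ` A)"
  shows "\<exists>t. \<forall>s. prefix t s \<longrightarrow> (\<exists>k\<in>A. prefix s (map (f k) [0..<Suc k]))"
proof -
  obtain t where t: "\<And>s. prefix t s \<Longrightarrow> cyl s \<inter> f ` A \<noteq> {}"
    using assms unfolding cantor_nowhere_dense_def by blast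
  have "\<exists>k\<in>A. prefix s (map (f k) [0..<Suc k])" if s: "prefix t s" for s
  proof -
    define v where "v = map (\<lambda>j. \<not> f j (length s + j)) [0..<length s]"
    have "prefix t (s @ v)" using s by (rule prefix_prefix)
    then obtain k where k: "k \<in> A" "f k \<in> cyl (s @ v)" using t by blast
    \<comment> \<open>Once \<open>k \<ge> length s\<close>, the first \<open>Suc k\<close> digits of
      \<open>f k\<close> are long enough to contain \<open>s\<close>.\<close>
    have "\<not> k < length s"
    proof
      assume "k < length s"
      then have "length s + k < length (s @ v)" by (simp add: v_def)
      then have "f k (length s + k) = (s @ v) ! (length s + k)"
        using k(2) unfolding cyl_def by blast
      then show False using \<open>k < length s\<close> by (simp add: v_def nth_append)
    qed
    moreover have "f k \<in> cyl s" using k(2) cyl_antimono[of s "s @ v"] by auto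
    ultimately show ?thesis using k(1) mem_cyl_prefix[of "f k" s "Suc k"] by auto
  qed
  then show ?thesis by blast
qed

section \<open>Points of the Stone space\<close>

locale forcing_poset =
  fixes P :: "'a set" and le :: "'a \<Rightarrow> 'a \<Rightarrow> bool"
  assumes forcing: "forcing_notion P le"
begin

lemma le_refl: "p \<in> P \<Longrightarrow> le p p"
  and le_trans: "p \<in> P \<Longrightarrow> q \<in> P \<Longrightarrow> r \<in> P \<Longrightarrow> le p q \<Longrightarrow> le q r \<Longrightarrow> le p r"
  and P_nonempty: "P \<noteq> {}"
  using forcing unfolding forcing_notion_def by blast+

definition upset :: "'a set \<Rightarrow> bool" where
  "upset S \<longleftrightarrow> S \<subseteq> P \<and> (\<forall>p\<in>S. \<forall>q\<in>P. le p q \<longrightarrow> q \<in> S)"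

definition cone :: "'a \<Rightarrow> 'a set" where
  "cone p = {q \<in> P. le p q}"

text \<open>For an upset \<open>S\<close> this is its pseudocomplement in the lattice of
  upsets.\<close>

definition perp :: "'a set \<Rightarrow> 'a set" where
  "perp S = {q \<in> P. cone q \<inter> S = {}}"

text \<open>Containing all dense upsets makes \<open>V\<close> choose between \<open>S\<close> and
  \<open>perp S\<close> for each upset \<open>S\<close>, so its trace on the regular upsets
  (\<open>S = perp (perp S)\<close>) is an ultrafilter of the Boolean completion.\<close>

definition generic_ultrafilter :: "'a set set \<Rightarrow> bool" where
  "generic_ultrafilter V \<longleftrightarrow> set_ultrafilter V \<and> (\<forall>E. upset E \<longrightarrow> dense_in P le E \<longrightarrow> E \<in> V)"

section \<open>Upsets, cones and dense sets\<close>

lemma upset_cone: "p \<in> P \<Longrightarrow> upset (cone p)"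
  unfolding upset_def cone_def using le_trans by blast

lemma mem_cone: "p \<in> P \<Longrightarrow> p \<in> cone p"
  unfolding cone_def using le_refl by blast

lemma upset_empty: "upset {}"
  and upset_Int: "upset S \<Longrightarrow> upset T \<Longrightarrow> upset (S \<inter> T)"
  and upset_Un: "upset S \<Longrightarrow> upset T \<Longrightarrow> upset (S \<union> T)"
  and upset_UN: "(\<And>i. i \<in> I \<Longrightarrow> upset (X i)) \<Longrightarrow> upset (\<Union>i\<in>I. X i)"
  and upset_Int_INT: "upset S \<Longrightarrow> (\<And>i. i \<in> I \<Longrightarrow> upset (X i)) \<Longrightarrow> upset (S \<inter> (\<Inter>i\<in>I. X i))"
  unfolding upset_def by blast+

lemma upset_perp: "upset (perp S)"
  unfolding upset_def perp_def cone_def using le_trans by blast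

lemma perp_disjoint: "upset S \<Longrightarrow> S \<inter> perp S = {}"
  unfolding perp_def upset_def using mem_cone by blast

lemma dense_Un_perp: "dense_in P le (S \<union> perp S)"
  unfolding dense_in_def
proof
  fix p assume "p \<in> P"
  show "\<exists>q\<in>P. le p q \<and> q \<in> S \<union> perp S"
  proof (cases "cone p \<inter> S = {}")
    case True
    then show ?thesis using \<open>p \<in> P\<close> le_refl unfolding perp_def by blast
  next
    case False
    then show ?thesis unfolding cone_def by blast
  qed
qed

lemma dense_Int:
  assumes "dense_in P le E" "dense_in P le E'" "upset E" "upset E'"
  shows "dense_in P le (E \<inter> E')"
  unfolding dense_in_def
proof
  fix p assume "p \<in> P"
  then obtain q where q: "q \<in> P" "le p q" "q \<in> E" using assms(1) unfolding dense_in_def by blast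
  then obtain r where r: "r \<in> P" "le q r" "r \<in> E'" using assms(2) unfolding dense_in_def by blast
  then show "\<exists>q\<in>P. le p q \<and> q \<in> E \<inter> E'"
    using q \<open>p \<in> P\<close> le_trans[of p q r] assms(3) unfolding upset_def by blast
qed

lemma generic_perp:
  assumes "generic_ultrafilter V" "upset S" "S \<notin> V"
  shows "perp S \<in> V"
proof -
  have "S \<union> perp S \<in> V"
    using assms dense_Un_perp upset_Un upset_perp unfolding generic_ultrafilter_def by blast
  then show ?thesis using assms set_ultrafilter_Un unfolding generic_ultrafilter_def by blast
qed

text \<open>The sets \<open>cone p \<inter> E\<close> with \<open>p \<in> A\<close> and
  \<open>E\<close> a dense upset form a filter base: directedness of \<open>A\<close> refines the
  cones, and dense upsets are closed under intersection.\<close>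

lemma generic_ultrafilter_of_directed:
  assumes "directed_in le A" "A \<subseteq> P" "A \<noteq> {}"
  shows "\<exists>V. generic_ultrafilter V \<and> (\<forall>p\<in>A. cone p \<in> V)"
proof -
  define B where "B = {cone p \<inter> E |p E. p \<in> A \<and> upset E \<and> dense_in P le E}"
  have PB: "upset P" "dense_in P le P"
    unfolding upset_def dense_in_def using le_refl by blast+
  have "{} \<notin> B"
    unfolding B_def dense_in_def cone_def using assms(2) by blast
  moreover have "B \<noteq> {}" unfolding B_def using assms(3) PB by blast
  moreover have "\<exists>R\<in>B. R \<subseteq> S \<inter> T" if "S \<in> B" "T \<in> B" for S T
  proof -
    obtain p E where p: "S = cone p \<inter> E" "p \<in> A" "upset E" "dense_in P le E"
      using \<open>S \<in> B\<close> unfolding B_def by blast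
    obtain q E' where q: "T = cone q \<inter> E'" "q \<in> A" "upset E'" "dense_in P le E'"
      using \<open>T \<in> B\<close> unfolding B_def by blast
    note pq = p q
    then obtain r where r: "r \<in> A" "le p r" "le q r"
      using assms(1) unfolding directed_in_def by blast
    have "p \<in> P" "q \<in> P" "r \<in> P" using r(1) pq assms(2) by auto
    then have "cone r \<subseteq> cone p" "cone r \<subseteq> cone q"
      unfolding cone_def using r le_trans by blast+
    moreover have "cone r \<inter> (E \<inter> E') \<in> B"
      unfolding B_def using r(1) pq upset_Int[of E E'] dense_Int[of E E'] by auto
    moreover have "cone r \<inter> (E \<inter> E') \<subseteq> S \<inter> T" using calculation(1,2) pq(1,5) by auto
    ultimately show ?thesis by blast
  qed
  ultimately obtain V where V: "set_ultrafilter V" "B \<subseteq> V"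
    using set_ultrafilter_extension[of B] by blast
  have *: "cone p \<inter> E \<in> V" if "p \<in> A" "upset E" "dense_in P le E" for p E
    using V(2) that unfolding B_def by blast
  have "E \<in> V" if "upset E" "dense_in P le E" for E
    using * that assms(3) set_ultrafilterD(2)[OF V(1)] by (meson ex_in_conv inf_le2)
  moreover have "cone p \<in> V" if "p \<in> A" for p
    using * that PB set_ultrafilterD(2)[OF V(1)] by (meson inf_le1)
  ultimately show ?thesis using V(1) unfolding generic_ultrafilter_def by blast
qed

lemma sigma_centered_points:
  assumes "sigma_centered P le"
  shows "\<exists>V :: nat \<Rightarrow> 'a set set.
    (\<forall>n. generic_ultrafilter (V n)) \<and> (\<forall>p\<in>P. \<exists>n. cone p \<in> V n)"
proof -
  obtain A :: "nat \<Rightarrow> 'a set" where A: "P = (\<Union>n. A n)" "\<And>n. directed_in le (A n)"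
    using assms unfolding sigma_centered_def by blast
  obtain m where m: "A m \<noteq> {}" using A(1) P_nonempty by blast
  have "\<exists>V. generic_ultrafilter V \<and> (\<forall>p\<in>A n. cone p \<in> V)" for n
  proof (cases "A n = {}")
    case True
    have "\<exists>V. generic_ultrafilter V" using generic_ultrafilter_of_directed[OF A(2) _ m] A(1) by blast
    then show ?thesis using True by blast
  next
    case False
    then show ?thesis using generic_ultrafilter_of_directed[OF A(2)] A(1) by blast
  qed
  then obtain V where "\<And>n. generic_ultrafilter (V n) \<and> (\<forall>p\<in>A n. cone p \<in> V n)" by metis
  then show ?thesis using A(1) by blast
qed

text \<open>Distinct ultrafilters may have the same trace on upsets, and the forcing sees only that
  trace.\<close>

definition same_point :: "'a set set \<Rightarrow> 'a set set \<Rightarrow> bool" where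
  "same_point V V' \<longleftrightarrow> (\<forall>S. upset S \<longrightarrow> S \<in> V \<longleftrightarrow> S \<in> V')"

text \<open>Distinct points differ on some upset \<open>S\<close>; if \<open>S\<close> lies on the
  wrong side, \<open>perp S\<close> separates in the required direction.\<close>

lemma separating_upset:
  assumes V: "generic_ultrafilter V" and V': "generic_ultrafilter V'" and "\<not> same_point V V'"
  shows "\<exists>S. upset S \<and> S \<in> V \<and> S \<notin> V'"
proof -
  obtain S where S: "upset S" "S \<in> V \<longleftrightarrow> S \<notin> V'" using assms(3) unfolding same_point_def by blast
  show ?thesis
  proof (cases "S \<in> V")
    case True
    then show ?thesis using S by blast
  next
    case False
    then have "perp S \<in> V" using generic_perp V S(1) by blast
    moreover have "perp S \<notin> V'"
      using S False perp_disjoint[OF S(1)] V' set_ultrafilterD(1,3)[of V']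
      unfolding generic_ultrafilter_def by metis
    ultimately show ?thesis using upset_perp by blast
  qed
qed

text \<open>Upsets separating the points \<open>V n\<close> from \<open>X\<close> are made disjoint
  by intersecting each with \<open>perp\<close> of the earlier ones; set complements would in
  general not be upsets.\<close>

lemma separating_antichain:
  fixes V :: "nat \<Rightarrow> 'a set set"
  assumes V: "\<And>n. generic_ultrafilter (V n)" and i: "generic_ultrafilter X"
  shows "\<exists>W. (\<forall>k. upset (W k)) \<and> (\<forall>j k. j \<noteq> k \<longrightarrow> W j \<inter> W k = {}) \<and> (\<forall>k. W k \<notin> X) \<and>
    (\<forall>n. \<not> same_point (V n) X \<longrightarrow> (\<exists>k::nat. W k \<in> V n))"
proof -
  have ultra: "set_ultrafilter X" "set_ultrafilter (V n)" for n
    using V i unfolding generic_ultrafilter_def by blast+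
  \<comment> \<open>When \<open>V n\<close> is the point \<open>X\<close> itself, the default is the
    empty upset.\<close>
  have "\<exists>G. upset G \<and> G \<notin> X \<and> (\<not> same_point (V n) X \<longrightarrow> G \<in> V n)" for n
    using separating_upset[OF V i, of n] upset_empty set_ultrafilterD(1)[OF ultra(1)] by metis
  then obtain G where G: "\<And>n. upset (G n)" "\<And>n. G n \<notin> X"
    "\<And>n. \<not> same_point (V n) X \<Longrightarrow> G n \<in> V n" by metis
  define W where "W k = G k \<inter> (\<Inter>j<k. perp (G j))" for k
  have "upset (W k)" for k
    unfolding W_def by (rule upset_Int_INT[OF G(1) upset_perp])
  moreover have disj: "W j \<inter> W k = {}" if "j < k" for j k
    using that perp_disjoint[OF G(1), of j] unfolding W_def by blast
  then have "W j \<inter> W k = {}" if "j \<noteq> k" for j k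
    using that by (metis Int_commute linorder_neqE_nat)
  moreover have "W k \<notin> X" for k
    using G(2)[of k] set_ultrafilterD(2)[OF ultra(1)] unfolding W_def by blast
  moreover have "\<exists>k. W k \<in> V n" if "\<not> same_point (V n) X" for n
  proof -
    \<comment> \<open>At the first \<open>G k\<close> in \<open>V n\<close>, the finitely many
      earlier \<open>perp (G j)\<close> all lie in \<open>V n\<close>, hence so does
      \<open>W k\<close>.\<close>
    define k where "k = (LEAST k. G k \<in> V n)"
    have "G k \<in> V n" unfolding k_def using G(3)[OF that] by (rule LeastI)
    moreover have "perp (G j) \<in> V n" if "j < k" for j
      using generic_perp[OF V G(1)] not_less_Least[of j "\<lambda>k. G k \<in> V n"] that
      unfolding k_def by blast
    ultimately have "W k \<in> V n"
      unfolding W_def by (intro set_ultrafilter_INT[OF ultra(2)]) auto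
    then show ?thesis ..
  qed
  ultimately show ?thesis by blast
qed

text \<open>Without isolated points, the points different from \<open>X\<close> still form a dense set.\<close>
lemma dense_UN_of_splitting:
  fixes V :: "nat \<Rightarrow> 'a set set"
  assumes V: "\<And>n. generic_ultrafilter (V n)" "\<And>p. p \<in> P \<Longrightarrow> \<exists>n. cone p \<in> V n"
    and "splitting P le" "generic_ultrafilter X"
    and W: "\<And>n. \<not> same_point (V n) X \<Longrightarrow> \<exists>k. W k \<in> V n"
  shows "dense_in P le (\<Union>k. W k)"
  unfolding dense_in_def
proof
  fix p assume "p \<in> P"
  then obtain q r where qr: "q \<in> P" "r \<in> P" "le p q" "le p r" "\<not> compatible P le q r"
    using assms(3) unfolding splitting_def by blast
  obtain a b where ab: "cone q \<in> V a" "cone r \<in> V b" using V(2) qr by blast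
  have "cone q \<inter> cone r = {}" using qr(5) unfolding compatible_def cone_def by blast
  \<comment> \<open>Disjoint cones cannot both belong to \<open>X\<close>, so one of the two halves
    is seen by a point other than \<open>X\<close>.\<close>
  then have "\<not> (same_point (V a) X \<and> same_point (V b) X)"
    using ab upset_cone qr(1,2) assms(4) set_ultrafilterD(1,3)[of X]
    unfolding same_point_def generic_ultrafilter_def by metis
  then obtain s n where s: "s \<in> P" "le p s" "cone s \<in> V n" "\<not> same_point (V n) X"
    using ab qr by blast
  then obtain k where "W k \<in> V n" using W by blast
  then have "cone s \<inter> W k \<noteq> {}"
    using s(3) V(1)[of n] set_ultrafilterD(1,3)[of "V n"] unfolding generic_ultrafilter_def by metis
  then obtain t where "t \<in> P" "le s t" "t \<in> W k" unfolding cone_def by blast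
  then show "\<exists>q\<in>P. le p q \<and> q \<in> (\<Union>k. W k)" using s \<open>p \<in> P\<close> le_trans by blast
qed

text \<open>This is the image of \<open>V\<close> under the map sending the elements of
  \<open>W k\<close> to \<open>k\<close>, defined on a set in \<open>V\<close> because the union is
  a dense upset; it is non-principal because no single \<open>W k\<close> lies in
  \<open>V\<close>.\<close>

lemma ultrafilter_of_antichain:
  assumes V: "generic_ultrafilter V"
    and W: "\<And>k::nat. upset (W k)" "\<And>j k. j \<noteq> k \<Longrightarrow> W j \<inter> W k = {}" "\<And>k. W k \<notin> V"
    and dense: "dense_in P le (\<Union>k. W k)"
  shows "is_ultrafilter {A. (\<Union>k\<in>A. W k) \<in> V}" "non_principal {A. (\<Union>k\<in>A. W k) \<in> V}"
proof -
  have ultra: "set_ultrafilter V" using V unfolding generic_ultrafilter_def by blast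
  note u = set_ultrafilterD[OF ultra]
  have all: "(\<Union>k. W k) \<in> V"
    using V dense upset_UN[of UNIV W] W(1) unfolding generic_ultrafilter_def by blast
  have up: "(\<Union>k\<in>B. W k) \<in> V" if "(\<Union>k\<in>A. W k) \<in> V" "A \<subseteq> B" for A B
    using that(1) by (rule u(2)) (use that(2) in blast)
  have inter: "(\<Union>k\<in>A \<inter> B. W k) \<in> V" if "(\<Union>k\<in>A. W k) \<in> V" "(\<Union>k\<in>B. W k) \<in> V" for A B
  proof -
    have "j = k" if "x \<in> W j" "x \<in> W k" for x j k using W(2)[of j k] that by blast
    then have "(\<Union>k\<in>A. W k) \<inter> (\<Union>k\<in>B. W k) \<subseteq> (\<Union>k\<in>A \<inter> B. W k)" by (auto; metis)
    with u(3)[OF that] show ?thesis by (rule u(2))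
  qed
  have ult: "(\<Union>k\<in>A. W k) \<in> V \<or> (\<Union>k\<in>- A. W k) \<in> V" for A
  proof -
    have "(\<Union>k\<in>A. W k) \<union> (\<Union>k\<in>- A. W k) = (\<Union>k. W k)" by blast
    then show ?thesis using set_ultrafilter_Un[OF ultra] all by metis
  qed
  show "is_ultrafilter {A. (\<Union>k\<in>A. W k) \<in> V}"
    unfolding is_ultrafilter_def is_filter_def mem_Collect_eq
    using all u(1) up inter ult by (intro conjI allI impI) auto
  show "non_principal {A. (\<Union>k\<in>A. W k) \<in> V}"
    unfolding non_principal_def using W(3) by simp
qed

section \<open>Names from sequences of antichains\<close>

text \<open>The name reads off \<open>seg i k\<close> at stage \<open>i\<close> when \<open>W i k\<close> is met. A condition must not decide all
  stages, since its value under the name is a finite list.\<close>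
lemma name_of_antichains:
  assumes W: "\<And>i k. upset (W i k)" "\<And>i j k. j \<noteq> k \<Longrightarrow> W i j \<inter> W i k = {}"
    "\<And>i. dense_in P le (\<Union>k. W i k)" "\<And>q. q \<in> P \<Longrightarrow> \<exists>i. \<forall>k. q \<notin> W i k"
    and seg: "\<And>i k. seg i k \<noteq> []"
  shows "\<exists>\<tau>. real_name P le \<tau> \<and> (\<forall>n \<kappa> q. q \<in> P \<longrightarrow> (\<forall>i<n. q \<in> W i (\<kappa> i)) \<longrightarrow>
    prefix (concat (map (\<lambda>i. seg i (\<kappa> i)) [0..<n])) (\<tau> q))"
proof -
  \<comment> \<open>The first stage that \<open>q\<close> leaves undecided. The name stops there
    even if \<open>q\<close> decides later stages, so that stronger conditions only prolong the
    list.\<close>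
  define N where "N q = (LEAST i. \<forall>k. q \<notin> W i k)" for q
  define idx where "idx i q = (THE k. q \<in> W i k)" for i q
  define \<tau> where "\<tau> q = concat (map (\<lambda>i. seg i (idx i q)) [0..<N q])" for q
  have idx: "idx i q = k" if "q \<in> W i k" for i q k
    unfolding idx_def using that W(2) by (blast intro: the_equality)
  have pre: "prefix (concat (map (\<lambda>i. seg i (\<kappa> i)) [0..<n])) (\<tau> q)"
    if "q \<in> P" and \<kappa>: "\<forall>i<n. q \<in> W i (\<kappa> i)" for n \<kappa> q
  proof -
    have "\<forall>k. q \<notin> W (N q) k" unfolding N_def by (rule LeastI_ex) (rule W(4)[OF that(1)])
    then have "n \<le> N q" using \<kappa> by (meson not_le)
    then have "[0..<N q] = [0..<n] @ [n..<N q]" using upt_add_eq_append[of 0 n "N q - n"] by simp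
    moreover have "map (\<lambda>i. seg i (idx i q)) [0..<n] = map (\<lambda>i. seg i (\<kappa> i)) [0..<n]"
      using idx \<kappa> by (intro map_cong) auto
    ultimately show ?thesis
      unfolding \<tau>_def by (simp only: map_append concat_append prefixI)
  qed
  have before: "q \<in> W i (idx i q)" if "i < N q" for i q
    using not_less_Least[OF that[unfolded N_def]] idx by auto
  have mono: "prefix (\<tau> p) (\<tau> q)" if "p \<in> P" "q \<in> P" "le p q" for p q
  proof -
    have "\<forall>i<N p. q \<in> W i (idx i p)" using before W(1) that unfolding upset_def by blast
    then show ?thesis using pre[OF that(2), of "N p" "\<lambda>i. idx i p"] unfolding \<tau>_def by blast
  qed
  have dense: "\<exists>q\<in>P. le p q \<and> (\<forall>i<n. \<exists>k. q \<in> W i k)" if "p \<in> P" for p n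
  proof (induction n)
    case 0
    then show ?case using that le_refl by blast
  next
    case (Suc n)
    then obtain q where q: "q \<in> P" "le p q" "\<forall>i<n. \<exists>k. q \<in> W i k" by blast
    then obtain r k where r: "r \<in> P" "le q r" "r \<in> W n k"
      using W(3)[of n] unfolding dense_in_def by blast
    have "\<forall>i<n. \<exists>k. r \<in> W i k" using q(3) r W(1) unfolding upset_def by blast
    then have "\<forall>i<Suc n. \<exists>k. r \<in> W i k" using r(3) less_Suc_eq by blast
    then show ?case using r q(1,2) that le_trans by blast
  qed
  \<comment> \<open>Each stage contributes at least one digit, so deciding enough stages decides any
    number of digits.\<close>
  have len: "n \<le> length (concat (map (\<lambda>i. seg i (\<kappa> i)) [0..<n]))" for n \<kappa>
  proof (induction n)
    case (Suc n)
    have "1 \<le> length (seg n (\<kappa> n))" using seg by (simp add: Suc_le_eq)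
    then show ?case using Suc by simp
  qed simp
  have "dense_in P le {q. n \<le> length (\<tau> q)}" for n
    unfolding dense_in_def
  proof
    fix p assume "p \<in> P"
    then obtain q where q: "q \<in> P" "le p q" "\<forall>i<n. \<exists>k. q \<in> W i k" using dense by blast
    then have "\<forall>i<n. q \<in> W i (idx i q)" using idx by blast
    then have "n \<le> length (\<tau> q)"
      using pre[OF q(1), of n "\<lambda>i. idx i q"] len[of n "\<lambda>i. idx i q"] prefix_length_le order_trans
      by blast
    then show "\<exists>q\<in>P. le p q \<and> q \<in> {q. n \<le> length (\<tau> q)}" using q by blast
  qed
  then have "real_name P le \<tau>" unfolding real_name_def using mono by blast
  then show ?thesis using pre by blast
qed

end

section \<open>The Cohen real and the contradiction\<close>

theorem theorem2:
  fixes P :: "'a set" and le :: "'a \<Rightarrow> 'a \<Rightarrow> bool"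
  assumes "forcing_notion P le"
    and "sigma_centered P le"
    and "splitting P le"
    and "\<not> adds_cohen_real P le"
  shows "\<exists>U. is_ultrafilter U \<and> non_principal U \<and> nowhere_dense_filter U"
proof (rule ccontr)
  assume none: "\<not> ?thesis"
  interpret forcing_poset P le by unfold_locales (rule assms(1))
  obtain V :: "nat \<Rightarrow> 'a set set"
    where V: "\<And>n. generic_ultrafilter (V n)" "\<And>p. p \<in> P \<Longrightarrow> \<exists>n. cone p \<in> V n"
    using sigma_centered_points[OF assms(2)] by blast
  have ultra: "set_ultrafilter (V n)" for n using V(1) unfolding generic_ultrafilter_def by blast
  note u = set_ultrafilterD[OF ultra]
  have "\<exists>W. (\<forall>k. upset (W k)) \<and> (\<forall>j k. j \<noteq> k \<longrightarrow> W j \<inter> W k = {}) \<and> (\<forall>k. W k \<notin> V i) \<and>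
    (\<forall>n. \<not> same_point (V n) (V i) \<longrightarrow> (\<exists>k::nat. W k \<in> V n))" for i
    using separating_antichain[OF V(1) V(1)] .
  then obtain W where W: "\<And>i k. upset (W i k)" "\<And>i j k. j \<noteq> k \<Longrightarrow> W i j \<inter> W i k = {}"
    "\<And>i k. W i k \<notin> V i" "\<And>i n. \<not> same_point (V n) (V i) \<Longrightarrow> \<exists>k::nat. W i k \<in> V n"
    by metis
  have dense: "dense_in P le (\<Union>k. W i k)" for i
    using dense_UN_of_splitting[OF V assms(3) V(1) W(4)] .
  \<comment> \<open>The image of \<open>V i\<close> along \<open>W i\<close> is a non-principal
    ultrafilter, so it is not nowhere dense; \<open>f\<close> witnesses this.\<close>
  have "\<exists>f. \<forall>A. (\<Union>k\<in>A. W i k) \<in> V i \<longrightarrow> \<not> cantor_nowhere_dense (f ` A)" for i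
    using none ultrafilter_of_antichain[OF V(1) W(1,2,3) dense, of i]
    unfolding nowhere_dense_filter_def by blast
  then obtain f where
    f: "\<And>i A. (\<Union>k\<in>A. W i k) \<in> V i \<Longrightarrow> \<not> cantor_nowhere_dense (f i ` A)" by metis
  define seg where "seg i k = map (f i k) [0..<Suc k]" for i k
  \<comment> \<open>If \<open>cone q \<in> V n\<close>, then \<open>q\<close> leaves stage
    \<open>n\<close> undecided, because no \<open>W n k\<close> belongs to
    \<open>V n\<close>.\<close>
  have undecided: "\<exists>i. \<forall>k. q \<notin> W i k" if q: "q \<in> P" for q
  proof -
    obtain n where n: "cone q \<in> V n" using V(2)[OF q] by blast
    have "q \<notin> W n k" for k
    proof
      assume "q \<in> W n k"
      then have "cone q \<subseteq> W n k" using W(1) unfolding upset_def cone_def by blast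
      then show False using n u(2) W(3) by blast
    qed
    then show ?thesis by blast
  qed
  have seg_nonempty: "seg i k \<noteq> []" for i k unfolding seg_def by simp
  obtain \<tau> where \<tau>: "real_name P le \<tau>" and pre: "\<And>n \<kappa> q. q \<in> P \<Longrightarrow> (\<forall>i<n. q \<in> W i (\<kappa> i)) \<Longrightarrow>
      prefix (concat (map (\<lambda>i. seg i (\<kappa> i)) [0..<n])) (\<tau> q)"
    using name_of_antichains[where seg = seg, OF W(1,2) dense undecided seg_nonempty] by blast
  have "forces_in_open P le \<tau> D" if D: "cantor_open D" "cantor_dense D" for D
    unfolding forces_in_open_def dense_in_def
  proof
    fix p assume p: "p \<in> P"
    then obtain n where n: "cone p \<in> V n" using V(2) by blast
    \<comment> \<open>The first stage left undecided at the point \<open>V n\<close>; it exists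
      because stage \<open>n\<close> is such a stage. By \<open>W(4)\<close>, \<open>V i\<close> is
      then the same point.\<close>
    define i where "i = (LEAST i. \<forall>k. W i k \<notin> V n)"
    have i: "\<forall>k. W i k \<notin> V n" unfolding i_def by (rule LeastI[of _ n]) (use W(3) in blast)
    then have same: "same_point (V n) (V i)" using W(4) by blast
    have "\<exists>k. W j k \<in> V n" if "j < i" for j
      using not_less_Least[OF that[unfolded i_def]] by blast
    then obtain \<kappa> where \<kappa>: "\<And>j. j < i \<Longrightarrow> W j (\<kappa> j) \<in> V n" by metis
    \<comment> \<open>The conditions extending \<open>p\<close> that decide the stages before
      \<open>i\<close> as \<open>V n\<close> does. Being an upset, \<open>B\<close> passes from
      \<open>V n\<close> to \<open>V i\<close>.\<close>
    define B where "B = cone p \<inter> (\<Inter>j\<in>{..<i}. W j (\<kappa> j))"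
    have "B \<in> V n" unfolding B_def using \<kappa> by (intro set_ultrafilter_INT[OF ultra _ n]) auto
    moreover have "upset B" unfolding B_def by (rule upset_Int_INT[OF upset_cone[OF p] W(1)])
    ultimately have "B \<in> V i" using same unfolding same_point_def by blast
    moreover have "(\<Union>k. W i k) \<in> V i"
      using V(1)[of i] dense upset_UN[of UNIV "W i"] W(1) unfolding generic_ultrafilter_def by blast
    ultimately have "B \<inter> (\<Union>k. W i k) \<in> V i" by (rule u(3))
    \<comment> \<open>The indices \<open>k\<close> for which \<open>W i k\<close> meets
      \<open>B\<close> are large for the image ultrafilter, so \<open>f i\<close> maps them onto a
      somewhere dense set.\<close>
    then have "(\<Union>k\<in>{k. B \<inter> W i k \<noteq> {}}. W i k) \<in> V i" by (rule u(2)) blast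
    from somewhere_dense_initial_segments[OF f[OF this]] obtain t where
      t: "\<And>s. prefix t s \<Longrightarrow> \<exists>k. B \<inter> W i k \<noteq> {} \<and> prefix s (seg i k)"
      unfolding seg_def by auto
    define \<sigma> where "\<sigma> = concat (map (\<lambda>j. seg j (\<kappa> j)) [0..<i])"
    \<comment> \<open>All of \<open>B\<close> already decides \<open>\<sigma>\<close>. Prolonging
      \<open>\<sigma> @ t\<close> into \<open>D\<close> leaves a piece \<open>t @ w\<close> to stage
      \<open>i\<close>, where some \<open>q \<in> B\<close> realizes a segment extending it.\<close>
    obtain v where v: "prefix (\<sigma> @ t) v" "cyl v \<subseteq> D" using dense_open_extension[OF D] by blast
    then obtain w where w: "v = \<sigma> @ t @ w" unfolding prefix_def by auto
    obtain k q where k: "prefix (t @ w) (seg i k)" and q: "q \<in> B" "q \<in> W i k"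
      using t[of "t @ w"] by auto
    have qP: "q \<in> P" "le p q" using q(1) unfolding B_def cone_def by auto
    have "\<forall>j<Suc i. q \<in> W j ((\<kappa>(i := k)) j)"
      using q unfolding B_def by (auto simp: less_Suc_eq)
    note pre[OF qP(1) this]
    also have "map (\<lambda>j. seg j ((\<kappa>(i := k)) j)) [0..<Suc i] =
        map (\<lambda>j. seg j (\<kappa> j)) [0..<i] @ [seg i k]"
      by auto
    also have "concat \<dots> = \<sigma> @ seg i k" unfolding \<sigma>_def by simp
    finally have "prefix (\<sigma> @ seg i k) (\<tau> q)" .
    then have "prefix v (\<tau> q)"
      unfolding w using k by (meson prefix_order.trans same_prefix_prefix)
    then have "cyl (\<tau> q) \<subseteq> D" using v(2) cyl_antimono by blast
    then show "\<exists>q\<in>P. le p q \<and> q \<in> {q. cyl (\<tau> q) \<subseteq> D}" using qP by blast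
  qed
  then show False using assms(4) \<tau> unfolding adds_cohen_real_def by blast
qed

end
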